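(* Let $X$ be a real Banach space. Then $X$ admits almost Daugavet points if and only if $\sup_{x \in S_X} dc(x)=2$.
   Context: $B_X$, $S_X$, $X^*$ denote the closed unit ball, unit sphere and topological dual of $X$. For $x\in B_X$ and $\varepsilon>0$ put $\Delta_\varepsilon(x)=\{y\in B_X : \|y-x\|\ge 2-\varepsilon\}$. $X$ admits almost Daugavet points if for every $\varepsilon>0$ there exists $x\in B_X$ such that $B_X\subseteq \overline{\operatorname{co}}\,\Delta_\varepsilon(x)$ (closed convex hull). A slice of $B_X$ is a set $S(x^*,\delta)=\{y\in B_X : x^*(y)>1-\delta\}$ with $x^*\in S_{X^*}$ and $\delta>0$. For $x\in B_X$, the Daugavet constant $dc(x)$ is the supremum of all $\alpha\ge 0$ such that for all $\varepsilon,\delta>0$ and all $y^*\in S_{X^*}$ there exists $y\in S(y^*,\delta)$ with $\|y-x\|>\alpha-\varepsilon$. *)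

theory Defs
  imports "HOL-Analysis.Analysis"
begin

text \<open>
  The topological dual of \<open>'a\<close> is the type \<open>'a \<Rightarrow>\<^sub>L real\<close> with its operator norm.
\<close>

definition far_set :: "real \<Rightarrow> 'a::real_normed_vector \<Rightarrow> 'a set"
  where "far_set \<epsilon> x = {y \<in> cball 0 1. norm (y - x) \<ge> 2 - \<epsilon>}"

definition admits_almost_Daugavet_points :: "'a::real_normed_vector itself \<Rightarrow> bool"
  where "admits_almost_Daugavet_points _ \<longleftrightarrow>
    (\<forall>\<epsilon>>0. \<exists>x\<in>cball (0::'a) 1. cball 0 1 \<subseteq> closure (convex hull (far_set \<epsilon> x)))"

definition slice :: "('a::real_normed_vector \<Rightarrow>\<^sub>L real) \<Rightarrow> real \<Rightarrow> 'a set"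
  where "slice f \<delta> = {y \<in> cball 0 1. blinfun_apply f y > 1 - \<delta>}"

text \<open>
  Suprema are taken in the extended reals, so that they are meaningful without
  nonemptiness or boundedness side conditions. On a nontrivial space, for \<open>x\<close> in the
  unit ball, the set below contains 0 and is bounded by 2. On the zero space the unit sphere
  is empty, and the supremum of the Daugavet constants over it is \<open>-\<infinity>\<close>.
\<close>

definition Daugavet_constant :: "'a::real_normed_vector \<Rightarrow> ereal"
  where "Daugavet_constant x =
    (SUP \<alpha>\<in>{\<alpha>::real. \<alpha> \<ge> 0 \<and>
        (\<forall>\<epsilon>>0. \<forall>\<delta>>0. \<forall>f\<in>sphere (0::'a \<Rightarrow>\<^sub>L real) 1.
           \<exists>y\<in>slice f \<delta>. norm (y - x) > \<alpha> - \<epsilon>)}. ereal \<alpha>)"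

end

theory Submission
  imports Defs
begin

text \<open>
  If \<open>x\<close> witnesses the almost Daugavet property for \<open>\<epsilon> < 1\<close>, then \<open>\<parallel>x\<parallel> \<ge> 1 - \<epsilon>\<close> because the far
  set is nonempty, so replacing \<open>x\<close> by \<open>x / \<parallel>x\<parallel>\<close> costs another \<open>\<epsilon>\<close>. For points of the sphere,
  the Hahn--Banach separation theorem says that the closed convex hull of the far set exhausts
  the ball exactly when the far set meets every slice.

  Both the separation theorem and functionals of norm 1 come from one construction: for
  \<open>p\<close> sublinear and \<open>d \<le> p\<close> on a convex set \<open>D\<close>, the function
  \<open>q x = inf {p (x + t c) - t d | t \<ge> 0, c \<in> D}\<close> is sublinear, lies below \<open>p\<close>, and any linear
  functional below \<open>q\<close> is at least \<open>d\<close> on \<open>D\<close>. Taking \<open>D = {v}\<close> shows that a minimal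
  sublinear functional is odd, hence linear.
\<close>

section \<open>Sublinear functionals\<close>

definition sublinear :: "('a::real_vector \<Rightarrow> real) \<Rightarrow> bool"
  where "sublinear p \<longleftrightarrow>
    (\<forall>x y. p (x + y) \<le> p x + p y) \<and> (\<forall>r x. r \<ge> 0 \<longrightarrow> p (r *\<^sub>R x) = r * p x)"

lemma sublinear_add: "sublinear p \<Longrightarrow> p (x + y) \<le> p x + p y"
  and sublinear_scale: "sublinear p \<Longrightarrow> r \<ge> 0 \<Longrightarrow> p (r *\<^sub>R x) = r * p x"
  by (auto simp: sublinear_def)

lemma sublinear_0: "sublinear p \<Longrightarrow> p 0 = 0"
  using sublinear_scale[of p 0 0] by simp

lemma sublinear_neg: "sublinear p \<Longrightarrow> - p (- x) \<le> p x"
  using sublinear_add[of p x "- x"] sublinear_0[of p] by simp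

lemma sublinear_norm: "sublinear (norm :: 'a::real_normed_vector \<Rightarrow> real)"
  by (simp add: sublinear_def norm_triangle_ineq)

text \<open>Applying the one-sided inequality to \<open>inverse r\<close> as well gives the reverse
  one, so infima need only be estimated from above.\<close>

lemma sublinearI_pos:
  assumes add: "\<And>x y. p (x + y) \<le> p x + p y"
    and zero: "p 0 = 0"
    and scale: "\<And>r x. r > 0 \<Longrightarrow> p (r *\<^sub>R x) \<le> r * p x"
  shows "sublinear p"
proof -
  have "p (r *\<^sub>R x) = r * p x" if "r \<ge> 0" for r x
  proof (cases "r = 0")
    case False
    then have r: "r > 0" using that by simp
    have "p x \<le> inverse r * p (r *\<^sub>R x)"
      using scale[of "inverse r" "r *\<^sub>R x"] r by simp
    then have "r * p x \<le> p (r *\<^sub>R x)"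
      using r by (simp add: field_simps)
    then show ?thesis using scale[OF r, of x] by simp
  qed (simp add: zero)
  then show ?thesis using add by (simp add: sublinear_def)
qed

text \<open>The chain condition gives subadditivity: two members used at \<open>x\<close> and at
  \<open>y\<close> can both be replaced by the smaller one. This supplies the bounds of chains for
  Zorn's lemma.\<close>

lemma sublinear_INF:
  assumes ne: "Q \<noteq> {}"
    and sub: "\<And>q. q \<in> Q \<Longrightarrow> sublinear q"
    and bdd: "\<And>x. bdd_below ((\<lambda>q. q x) ` Q)"
    and chain: "\<And>q q'. q \<in> Q \<Longrightarrow> q' \<in> Q \<Longrightarrow> q \<le> q' \<or> q' \<le> q"
  shows "sublinear (\<lambda>x. INF q\<in>Q. q x)"
proof (rule sublinearI_pos)
  fix x y
  have "(INF q\<in>Q. q (x + y)) - q' y \<le> q x" if q: "q \<in> Q" and q': "q' \<in> Q" for q q'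
  proof -
    obtain m where m: "m \<in> Q" "m \<le> q" "m \<le> q'"
      using chain[OF q q'] q q' by auto
    have "(INF q\<in>Q. q (x + y)) \<le> m (x + y)"
      by (rule cINF_lower[OF bdd m(1)])
    also have "\<dots> \<le> m x + m y" by (rule sublinear_add[OF sub[OF m(1)]])
    also have "\<dots> \<le> q x + q' y" using m by (simp add: le_fun_def add_mono)
    finally show ?thesis by simp
  qed
  then have "(INF q\<in>Q. q (x + y)) - q' y \<le> (INF q\<in>Q. q x)" if "q' \<in> Q" for q'
    using that by (intro cINF_greatest[OF ne]) auto
  then have "(INF q\<in>Q. q (x + y)) - (INF q\<in>Q. q x) \<le> (INF q\<in>Q. q y)"
    by (intro cINF_greatest[OF ne]) (auto simp: algebra_simps)
  then show "(INF q\<in>Q. q (x + y)) \<le> (INF q\<in>Q. q x) + (INF q\<in>Q. q y)" by simp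
next
  show "(INF q\<in>Q. q 0) = 0"
    using ne sub by (simp add: sublinear_0 cong: INF_cong)
next
  fix r :: real and x assume r: "r > 0"
  have "(INF q\<in>Q. q (r *\<^sub>R x)) / r \<le> q x" if "q \<in> Q" for q
    using cINF_lower[OF bdd that, of "r *\<^sub>R x"] r sublinear_scale[OF sub[OF that], of r x]
    by (simp add: field_simps)
  then have "(INF q\<in>Q. q (r *\<^sub>R x)) / r \<le> (INF q\<in>Q. q x)"
    by (intro cINF_greatest[OF ne])
  then show "(INF q\<in>Q. q (r *\<^sub>R x)) \<le> r * (INF q\<in>Q. q x)"
    using r by (simp add: field_simps)
qed

text \<open>The conclusion is stated at \<open>- c\<close> because a linear functional below
  \<open>q\<close> turns \<open>q (- c) \<le> - d\<close> into a lower bound \<open>d\<close> at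
  \<open>c\<close>.\<close>

lemma sublinear_lower_on_convex:
  assumes p: "sublinear p" and D: "convex D" "D \<noteq> {}" and d: "\<And>c. c \<in> D \<Longrightarrow> d \<le> p c"
  obtains q where "sublinear q" "q \<le> p" "\<And>c. c \<in> D \<Longrightarrow> q (- c) \<le> - d"
proof -
  define I where "I = {0::real..} \<times> D"
  define h where "h = (\<lambda>x (t, c). p (x + t *\<^sub>R c) - t * d)"
  define q where "q = (\<lambda>x. INF i\<in>I. h x i)"
  have ne: "I \<noteq> {}" using D by (auto simp: I_def)
  \<comment> \<open>This is where \<open>d \<le> p c\<close> enters: the bound is independent of
    \<open>t\<close> and \<open>c\<close>, so the infimum is finite.\<close>
  have low: "- p (- x) \<le> h x i" if "i \<in> I" for x i
  proof -
    from that obtain t c where i: "i = (t, c)" "t \<ge> 0" "c \<in> D" by (auto simp: I_def)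
    have "t * d \<le> t * p c" using i d by (simp add: mult_left_mono)
    also have "\<dots> = p ((x + t *\<^sub>R c) + - x)" using i by (simp add: sublinear_scale[OF p])
    also have "\<dots> \<le> p (x + t *\<^sub>R c) + p (- x)" by (rule sublinear_add[OF p])
    finally show ?thesis by (simp add: h_def i)
  qed
  have bdd: "bdd_below (h x ` I)" for x
    using low by (intro bdd_belowI2[where m = "- p (- x)"]) auto
  have q_le: "q x \<le> p (x + t *\<^sub>R c) - t * d" if "t \<ge> 0" "c \<in> D" for x t c
    using cINF_lower[OF bdd, of "(t, c)" x] that by (simp add: q_def h_def I_def)
  have q_ge: "a \<le> q x" if "\<And>t c. t \<ge> 0 \<Longrightarrow> c \<in> D \<Longrightarrow> a \<le> p (x + t *\<^sub>R c) - t * d" for a x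
    unfolding q_def using that by (intro cINF_greatest[OF ne]) (auto simp: I_def h_def)
  obtain c0 where c0: "c0 \<in> D" using D by auto
  have q_p: "q x \<le> p x" for x using q_le[of 0 c0 x] c0 by simp
  have "sublinear q"
  proof (rule sublinearI_pos)
    fix x y
    have *: "q (x + y) \<le> (p (x + t *\<^sub>R c) - t * d) + (p (y + s *\<^sub>R e) - s * d)"
      if ts: "t \<ge> 0" "c \<in> D" "s \<ge> 0" "e \<in> D" for t c s e
    proof -
      \<comment> \<open>Convexity merges two competitors into one: \<open>g\<close> is the weighted
        mean of \<open>c\<close> and \<open>e\<close>, or any point of \<open>D\<close> when both
        weights vanish.\<close>
      obtain g where g: "g \<in> D" "t *\<^sub>R c + s *\<^sub>R e = (t + s) *\<^sub>R g"
      proof (cases "t + s = 0")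
        case True
        then have "t = 0" "s = 0" using ts by auto
        then show ?thesis using that[of c] ts by simp
      next
        case False
        have "(t / (t + s)) *\<^sub>R c + (s / (t + s)) *\<^sub>R e \<in> D"
          using ts False by (intro convexD[OF D(1)]) (auto simp: add_divide_distrib[symmetric])
        then show ?thesis using that False by (simp add: scaleR_add_right)
      qed
      have "q (x + y) \<le> p (x + y + (t + s) *\<^sub>R g) - (t + s) * d"
        using q_le g ts by simp
      also have "x + y + (t + s) *\<^sub>R g = (x + t *\<^sub>R c) + (y + s *\<^sub>R e)"
        using g(2) by (simp add: algebra_simps)
      also have "p \<dots> \<le> p (x + t *\<^sub>R c) + p (y + s *\<^sub>R e)" by (rule sublinear_add[OF p])
      finally show ?thesis by (simp add: algebra_simps)
    qed
    have "q (x + y) - (p (y + s *\<^sub>R e) - s * d) \<le> q x" if "s \<ge> 0" "e \<in> D" for s e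
      using *[OF _ _ that] by (intro q_ge) (simp add: algebra_simps)
    then have "q (x + y) - q x \<le> q y"
      by (intro q_ge) (simp add: algebra_simps)
    then show "q (x + y) \<le> q x + q y" by simp
  next
    have "0 \<le> q 0"
      unfolding q_def using low[of _ 0] by (intro cINF_greatest[OF ne]) (simp add: sublinear_0[OF p])
    then show "q 0 = 0" using q_p[of 0] by (simp add: sublinear_0[OF p])
  next
    fix r :: real and x assume r: "r > 0"
    have "q (r *\<^sub>R x) / r \<le> q x"
    proof (rule q_ge)
      fix t c assume tc: "t \<ge> (0::real)" "c \<in> D"
      have "q (r *\<^sub>R x) \<le> p (r *\<^sub>R x + (r * t) *\<^sub>R c) - (r * t) * d"
        using q_le tc r by simp
      also have "r *\<^sub>R x + (r * t) *\<^sub>R c = r *\<^sub>R (x + t *\<^sub>R c)" by (simp add: scaleR_add_right)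
      also have "p \<dots> = r * p (x + t *\<^sub>R c)" using r by (simp add: sublinear_scale[OF p])
      finally show "q (r *\<^sub>R x) / r \<le> p (x + t *\<^sub>R c) - t * d" using r by (simp add: field_simps)
    qed
    then show "q (r *\<^sub>R x) \<le> r * q x" using r by (simp add: field_simps)
  qed
  \<comment> \<open>The competitor \<open>t = 1\<close> cancels \<open>- c\<close> against
    \<open>c\<close> and leaves \<open>p 0 - d\<close>.\<close>
  moreover have "q (- c) \<le> - d" if "c \<in> D" for c
    using q_le[of 1 c "- c"] that by (simp add: sublinear_0[OF p])
  ultimately show ?thesis using that q_p by (simp add: le_fun_def)
qed

section \<open>Linear functionals as minimal sublinear functionals\<close>

text \<open>Lowering \<open>q\<close> on \<open>{v}\<close> with \<open>d = q v\<close> changes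
  nothing by minimality, so \<open>q (- v) \<le> - q v\<close>. An odd subadditive function is
  additive, and oddness extends homogeneity to negative scalars.\<close>

lemma minimal_sublinear_imp_linear:
  assumes q: "sublinear q" and minimal: "\<And>q'. sublinear q' \<Longrightarrow> q' \<le> q \<Longrightarrow> q' = q"
  shows "linear q"
proof -
  have le: "q (- v) \<le> - q v" for v
  proof -
    obtain q' where q': "sublinear q'" "q' \<le> q" "q' (- v) \<le> - q v"
      by (rule sublinear_lower_on_convex[OF q, of "{v}" "q v"]) auto
    then show ?thesis using minimal by blast
  qed
  have odd: "q (- v) = - q v" for v
    using le[of v] sublinear_neg[OF q, of v] by simp
  show ?thesis
  proof (rule linearI)
    fix x y
    have "q (- x + - y) \<le> q (- x) + q (- y)" by (rule sublinear_add[OF q])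
    then show "q (x + y) = q x + q y"
      using sublinear_add[OF q, of x y] odd[of "x + y"] odd by simp
  next
    fix r x
    show "q (r *\<^sub>R x) = r *\<^sub>R q x"
    proof (cases "r \<ge> 0")
      case False
      then have "q ((- r) *\<^sub>R x) = (- r) * q x" by (intro sublinear_scale[OF q]) simp
      then show ?thesis using odd[of "r *\<^sub>R x"] by simp
    qed (simp add: sublinear_scale[OF q])
  qed
qed

lemma linear_below_sublinear:
  fixes p :: "'a::real_vector \<Rightarrow> real"
  assumes p: "sublinear p"
  obtains f where "linear f" "f \<le> p"
proof -
  define A where "A = {q. sublinear q \<and> q \<le> p}"
  \<comment> \<open>The order is reversed, since Zorn's lemma yields maximal elements and a minimal
    functional is wanted.\<close>
  define P :: "('a \<Rightarrow> real) \<Rightarrow> ('a \<Rightarrow> real) \<Rightarrow> bool" where "P = (\<lambda>a b. b \<le> a)"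
  have "\<exists>m\<in>A. \<forall>a\<in>A. P m a \<longrightarrow> a = m"
  proof (rule predicate_Zorn)
    show "partial_order_on A (relation_of P A)"
      by (rule partial_order_on_relation_ofI) (auto simp: P_def)
  next
    fix C assume C: "C \<in> Chains (relation_of P A)"
    have CA: "C \<subseteq> A" using Chains_relation_of[OF C] .
    show "\<exists>u\<in>A. \<forall>a\<in>C. P a u"
    proof (cases "C = {}")
      case True
      then show ?thesis using p by (auto simp: A_def)
    next
      case False
      have low: "- p (- x) \<le> q x" if "q \<in> C" for q x
      proof -
        have "sublinear q" "q (- x) \<le> p (- x)" using that CA by (auto simp: A_def le_fun_def)
        then show ?thesis using sublinear_neg[of q x] by simp
      qed
      have bdd: "bdd_below ((\<lambda>q. q x) ` C)" for x
        using low by (intro bdd_belowI2[where m = "- p (- x)"]) auto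
      define u where "u = (\<lambda>x. INF q\<in>C. q x)"
      have "sublinear u"
        unfolding u_def
      proof (rule sublinear_INF[OF False _ bdd])
        show "sublinear q" if "q \<in> C" for q using that CA by (auto simp: A_def)
        show "q \<le> q' \<or> q' \<le> q" if "q \<in> C" "q' \<in> C" for q q'
          using C that by (auto simp: Chains_def relation_of_def P_def)
      qed
      moreover have u_le: "u \<le> q" if "q \<in> C" for q
        using cINF_lower[OF bdd that] by (simp add: u_def le_fun_def)
      moreover have "u \<le> p"
      proof -
        obtain q where "q \<in> C" using False by blast
        then have "u \<le> q" "q \<le> p" using u_le CA by (auto simp: A_def)
        then show ?thesis by (rule order_trans)
      qed
      ultimately show ?thesis by (auto simp: A_def P_def)
    qed
  qed
  then obtain m where m: "m \<in> A" "\<And>a. a \<in> A \<Longrightarrow> a \<le> m \<Longrightarrow> a = m"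
    by (auto simp: P_def)
  have "linear m"
  proof (rule minimal_sublinear_imp_linear)
    show "sublinear m" using m(1) by (simp add: A_def)
    fix q assume q: "sublinear q" "q \<le> m"
    \<comment> \<open>Minimality within \<open>A\<close> is minimality among all sublinear
      functionals, because whatever lies below \<open>m\<close> lies below \<open>p\<close>.\<close>
    have "m \<le> p" using m(1) by (simp add: A_def)
    then have "q \<in> A" using q order_trans[of q m p] by (simp add: A_def)
    then show "q = m" using m(2) q(2) by blast
  qed
  then show ?thesis using that m by (auto simp: A_def)
qed

section \<open>Separation in normed spaces\<close>

text \<open>The norm is the sublinear functional to be lowered on \<open>D\<close>. A linear
  \<open>g\<close> below the result stays below the norm, at \<open>x\<close> and at
  \<open>- x\<close>, hence has operator norm at most 1.\<close>

lemma functional_ge_on_convex: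
  fixes D :: "'a::real_normed_vector set"
  assumes D: "convex D" "D \<noteq> {}" and d: "\<And>c. c \<in> D \<Longrightarrow> d \<le> norm c"
  obtains f :: "'a \<Rightarrow>\<^sub>L real" where "norm f \<le> 1" "\<And>c. c \<in> D \<Longrightarrow> d \<le> blinfun_apply f c"
proof -
  obtain q where q: "sublinear q" "q \<le> norm" "\<And>c. c \<in> D \<Longrightarrow> q (- c) \<le> - d"
    using sublinear_lower_on_convex[OF sublinear_norm D d] by metis
  obtain g where g: "linear g" "g \<le> q" using linear_below_sublinear[OF q(1)] .
  have le: "g x \<le> norm x" for x using g q by (meson le_funD order_trans)
  have abs: "norm (g x) \<le> norm x * 1" for x
    using le[of x] le[of "- x"] linear_neg[OF g(1), of x] by (simp add: abs_le_iff)
  have bl: "bounded_linear g"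
    using g(1) abs by (intro bounded_linear_intro[of g 1]) (simp_all add: linear_add linear_scale)
  have ap: "blinfun_apply (Blinfun g) = g" using bl by (rule bounded_linear_Blinfun_apply)
  have "norm (Blinfun g) \<le> 1" using abs by (intro norm_blinfun_bound) (auto simp: ap)
  moreover have "d \<le> blinfun_apply (Blinfun g) c" if "c \<in> D" for c
    using q(3)[OF that] g(2) linear_neg[OF g(1), of c] by (auto simp: ap dest: le_funD[of _ _ "- c"])
  ultimately show ?thesis using that by blast
qed

text \<open>On the convex set of differences \<open>z - y\<close> with \<open>y\<close> in
  \<open>C\<close> the norm is at least the distance from \<open>z\<close> to \<open>C\<close>,
  which is positive because \<open>C\<close> is closed.\<close>

lemma separate_closed_convex_point:
  fixes C :: "'a::real_normed_vector set"
  assumes C: "convex C" "closed C" "C \<noteq> {}" and z: "z \<notin> C"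
  obtains f :: "'a \<Rightarrow>\<^sub>L real" and d
  where "norm f \<le> 1" "d > 0" "\<And>y. y \<in> C \<Longrightarrow> blinfun_apply f y + d \<le> blinfun_apply f z"
proof -
  define d where "d = infdist z C"
  have d: "d > 0" unfolding d_def using infdist_pos_not_in_closed C z by blast
  obtain f :: "'a \<Rightarrow>\<^sub>L real" where f: "norm f \<le> 1"
    "\<And>c. c \<in> (\<lambda>y. z - y) ` C \<Longrightarrow> d \<le> blinfun_apply f c"
  proof (rule functional_ge_on_convex[of "(\<lambda>y. z - y) ` C" d])
    show "convex ((\<lambda>y. z - y) ` C)" using convex_translation[OF convex_negations[OF C(1)], of z] by (simp add: image_image)
    show "d \<le> norm c" if "c \<in> (\<lambda>y. z - y) ` C" for c
      using that infdist_le[of _ C z] by (auto simp: d_def dist_norm)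
  qed (use C in auto)
  show ?thesis
    using f d by (intro that[of f d]) (force simp: blinfun.diff_right)+
qed

text \<open>Conditions quantified over functionals of norm 1 are not vacuous once such a functional
  exists.\<close>

lemma unit_functional:
  fixes x :: "'a::real_normed_vector"
  assumes "norm x = 1"
  obtains f :: "'a \<Rightarrow>\<^sub>L real" where "norm f = 1"
proof -
  obtain f :: "'a \<Rightarrow>\<^sub>L real" where f: "norm f \<le> 1" "1 \<le> blinfun_apply f x"
    by (rule functional_ge_on_convex[of "{x}" 1]) (use assms in auto)
  have "1 \<le> norm f" using norm_blinfun[of f x] f assms by simp
  then show ?thesis using f that by force
qed

section \<open>Daugavet constants\<close>

lemma far_set_subset_cball: "far_set \<epsilon> x \<subseteq> cball 0 1"
  by (auto simp: far_set_def)

section \<open>Slices and closed convex hulls\<close>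

text \<open>A set missing the slice lies in the closed half-space \<open>H\<close>; then so does the
  whole ball, which forces \<open>norm f \<le> 1 - \<delta>\<close>.\<close>

lemma slice_meets_if_ball_subset_hull:
  fixes S :: "'a::real_normed_vector set" and f :: "'a \<Rightarrow>\<^sub>L real"
  assumes S: "S \<subseteq> cball 0 1" and sub: "cball 0 1 \<subseteq> closure (convex hull S)"
    and f: "norm f = 1" and \<delta>: "\<delta> > 0"
  shows "S \<inter> slice f \<delta> \<noteq> {}"
proof
  assume empty: "S \<inter> slice f \<delta> = {}"
  define H where "H = {y. blinfun_apply f y \<le> 1 - \<delta>}"
  have "convex H"
    by (auto simp: H_def convex_def blinfun.add_right blinfun.scaleR_right intro: convex_bound_le)
  moreover have "closed H"
    unfolding H_def by (intro closed_Collect_le continuous_intros)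
  moreover have "S \<subseteq> H" using empty S by (force simp: H_def slice_def)
  ultimately have H: "cball 0 1 \<subseteq> H"
    using sub by (meson closure_minimal hull_minimal order_trans)
  \<comment> \<open>This makes \<open>1 - \<delta>\<close> nonnegative, as a bound on the operator
    norm has to be.\<close>
  then have "0 \<in> H" by auto
  then have \<delta>1: "\<delta> \<le> 1" by (simp add: H_def)
  have le: "blinfun_apply f x \<le> (1 - \<delta>) * norm x" for x
  proof (cases "x = 0")
    case False
    then have "x /\<^sub>R norm x \<in> H" using H by (auto simp: subset_iff)
    then show ?thesis using False by (simp add: H_def blinfun.scaleR_right field_simps)
  qed simp
  have "norm f \<le> 1 - \<delta>"
  proof (rule norm_blinfun_bound)
    show "norm (blinfun_apply f x) \<le> (1 - \<delta>) * norm x" for x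
      using le[of x] le[of "- x"] by (simp add: blinfun.minus_right abs_le_iff)
  qed (use \<delta>1 in simp)
  then show False using f \<delta> by simp
qed

text \<open>A functional \<open>f\<close> separating \<open>z\<close> from the hull with gap
  \<open>d\<close> satisfies \<open>f \<le> norm f - d\<close> on \<open>S\<close>, so
  \<open>S\<close> misses the slice of width \<open>d\<close> given by the normalized
  functional.\<close>

lemma ball_subset_hull_if_slices_meet:
  fixes S :: "'a::real_normed_vector set"
  assumes "norm (x::'a) = 1"
    and meet: "\<And>f \<delta>. norm f = 1 \<Longrightarrow> \<delta> > 0 \<Longrightarrow> S \<inter> slice f \<delta> \<noteq> {}"
  shows "cball 0 1 \<subseteq> closure (convex hull S)"
proof
  fix z :: 'a assume z: "z \<in> cball 0 1"
  obtain f0 :: "'a \<Rightarrow>\<^sub>L real" where "norm f0 = 1" using unit_functional[OF assms(1)] .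
  then have ne: "S \<noteq> {}" using meet[of f0 1] by auto
  show "z \<in> closure (convex hull S)"
  proof (rule ccontr)
    assume "z \<notin> closure (convex hull S)"
    then obtain f :: "'a \<Rightarrow>\<^sub>L real" and d where f: "norm f \<le> 1" "d > 0"
      "\<And>y. y \<in> closure (convex hull S) \<Longrightarrow> blinfun_apply f y + d \<le> blinfun_apply f z"
      using separate_closed_convex_point[of "closure (convex hull S)" z] ne
      by (metis closed_closure closure_eq_empty convex_closure convex_convex_hull convex_hull_eq_empty)
    have fS: "blinfun_apply f y + d \<le> blinfun_apply f z" if "y \<in> S" for y
      using f(3) that by (meson closure_subset hull_subset subsetD)
    have fz: "blinfun_apply f z \<le> norm f"
      using norm_blinfun[of f z] z mult_left_le[of "norm z" "norm f"] by simp
    have f0: "f \<noteq> 0" using fS ne f(2) by auto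
    define g where "g = f /\<^sub>R norm f"
    have "norm g = 1" using f0 by (simp add: g_def)
    then obtain y where y: "y \<in> S" "y \<in> slice g d"
      using meet[of g d] f(2) by blast
    have "norm f * (1 - d) < blinfun_apply f y"
      using y(2) f0 by (simp add: slice_def g_def blinfun.scaleR_left field_simps)
    \<comment> \<open>Since \<open>norm f \<le> 1\<close>, rescaling does not enlarge the gap, so
      \<open>d\<close> serves as the width of the slice.\<close>
    moreover have "norm f * d \<le> d" using f by (simp add: mult_left_le_one_le)
    ultimately show False using fS[OF y(1)] fz by (simp add: algebra_simps)
  qed
qed

section \<open>Far sets and bounds on the Daugavet constant\<close>

text \<open>One functional of norm 1 provides a slice, and its points are at distance at most 2 from
  \<open>x\<close>.\<close>

lemma Daugavet_constant_le_2:
  fixes x :: "'a::real_normed_vector"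
  assumes x: "norm x = 1"
  shows "Daugavet_constant x \<le> 2"
  unfolding Daugavet_constant_def
proof (rule SUP_least)
  fix \<alpha> :: real
  assume "\<alpha> \<in> {\<alpha>. \<alpha> \<ge> 0 \<and> (\<forall>\<epsilon>>0. \<forall>\<delta>>0. \<forall>f\<in>sphere (0::'a \<Rightarrow>\<^sub>L real) 1.
           \<exists>y\<in>slice f \<delta>. norm (y - x) > \<alpha> - \<epsilon>)}"
  then have *: "\<exists>y\<in>slice f 1. norm (y - x) > \<alpha> - \<epsilon>" if "\<epsilon> > 0" "norm f = 1" for \<epsilon> f
    using that by auto
  obtain f :: "'a \<Rightarrow>\<^sub>L real" where f: "norm f = 1" using unit_functional[OF x] .
  have "\<alpha> \<le> 2 + \<epsilon>" if \<epsilon>: "\<epsilon> > 0" for \<epsilon>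
  proof -
    obtain y where "y \<in> slice f 1" "norm (y - x) > \<alpha> - \<epsilon>" using *[OF \<epsilon> f] by blast
    then show ?thesis using norm_triangle_ineq4[of y x] x by (auto simp: slice_def)
  qed
  then have "\<alpha> \<le> 2" by (rule field_le_epsilon)
  then show "ereal \<alpha> \<le> 2" by simp
qed

lemma Daugavet_constant_ge:
  fixes x :: "'a::real_normed_vector"
  assumes "\<alpha> \<ge> 0"
    and "\<And>f \<delta>. norm f = 1 \<Longrightarrow> \<delta> > 0 \<Longrightarrow> \<exists>y\<in>slice f \<delta>. norm (y - x) \<ge> \<alpha>"
  shows "ereal \<alpha> \<le> Daugavet_constant x"
  unfolding Daugavet_constant_def
proof (rule SUP_upper, safe)
  fix \<epsilon> \<delta> :: real and f :: "'a \<Rightarrow>\<^sub>L real"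
  assume "\<epsilon> > 0" "\<delta> > 0" "f \<in> sphere 0 1"
  then show "\<exists>y\<in>slice f \<delta>. norm (y - x) > \<alpha> - \<epsilon>"
    using assms(2)[of f \<delta>] by force
qed (use assms in simp)

lemma ball_subset_hull_far_set:
  fixes x :: "'a::real_normed_vector"
  assumes x: "norm x = 1" and dc: "ereal (2 - \<epsilon>) < Daugavet_constant x"
  shows "cball 0 1 \<subseteq> closure (convex hull (far_set \<epsilon> x))"
proof (rule ball_subset_hull_if_slices_meet[OF x])
  obtain \<alpha> where \<alpha>: "2 - \<epsilon> < \<alpha>" and *: "\<And>\<eta> \<delta> f. \<eta> > 0 \<Longrightarrow> \<delta> > 0 \<Longrightarrow> norm f = 1 \<Longrightarrow>
      \<exists>y\<in>slice f \<delta>. norm (y - x) > \<alpha> - \<eta>"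
    using dc by (auto simp: Daugavet_constant_def less_SUP_iff)
  fix f :: "'a \<Rightarrow>\<^sub>L real" and \<delta> :: real assume "norm f = 1" "\<delta> > 0"
  then obtain y where "y \<in> slice f \<delta>" "norm (y - x) > 2 - \<epsilon>"
    \<comment> \<open>The slack is chosen so that \<open>\<alpha>\<close> minus it is exactly
      \<open>2 - \<epsilon>\<close>.\<close>
    using *[of "\<alpha> - (2 - \<epsilon>)" \<delta> f] \<alpha> by auto
  then show "far_set \<epsilon> x \<inter> slice f \<delta> \<noteq> {}"
    by (auto simp: far_set_def slice_def)
qed

lemma Daugavet_constant_normalize_ge:
  fixes x :: "'a::real_normed_vector"
  assumes \<epsilon>: "0 < \<epsilon>" "\<epsilon> < 1" and x: "x \<in> cball 0 1"
    and sub: "cball 0 1 \<subseteq> closure (convex hull (far_set \<epsilon> x))"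
  shows "norm (x /\<^sub>R norm x) = 1" "ereal (2 - 2 * \<epsilon>) \<le> Daugavet_constant (x /\<^sub>R norm x)"
proof -
  have "far_set \<epsilon> x \<noteq> {}" using sub by auto
  then obtain y where "norm y \<le> 1" "norm (y - x) \<ge> 2 - \<epsilon>" by (auto simp: far_set_def)
  then have nx: "norm x \<ge> 1 - \<epsilon>" using norm_triangle_ineq4[of y x] by simp
  then have x0: "x \<noteq> 0" using \<epsilon> by auto
  then show "norm (x /\<^sub>R norm x) = 1" by simp
  \<comment> \<open>Normalizing moves \<open>x\<close> radially, by exactly
    \<open>\<bar>norm x - 1\<bar>\<close>.\<close>
  have "x - x /\<^sub>R norm x = (norm x - 1) *\<^sub>R (x /\<^sub>R norm x)"
    using x0 by (simp add: scaleR_diff_left left_diff_distrib)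
  then have "norm (x - x /\<^sub>R norm x) = \<bar>norm x - 1\<bar>" using x0 by (simp add: abs_mult)
  then have close: "norm (x - x /\<^sub>R norm x) \<le> \<epsilon>" using nx x by simp
  show "ereal (2 - 2 * \<epsilon>) \<le> Daugavet_constant (x /\<^sub>R norm x)"
  proof (rule Daugavet_constant_ge)
    fix f :: "'a \<Rightarrow>\<^sub>L real" and \<delta> :: real assume "norm f = 1" "\<delta> > 0"
    then obtain y where y: "y \<in> far_set \<epsilon> x" "y \<in> slice f \<delta>"
      using slice_meets_if_ball_subset_hull[OF far_set_subset_cball sub, of f \<delta>] by blast
    have "norm (y - x /\<^sub>R norm x) \<ge> norm (y - x) - norm (x - x /\<^sub>R norm x)"
      using norm_triangle_ineq[of "y - x /\<^sub>R norm x" "x /\<^sub>R norm x - x"]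
      by (simp add: norm_minus_commute)
    then have "norm (y - x /\<^sub>R norm x) \<ge> 2 - 2 * \<epsilon>"
      using y(1) close by (simp add: far_set_def)
    then show "\<exists>y\<in>slice f \<delta>. norm (y - x /\<^sub>R norm x) \<ge> 2 - 2 * \<epsilon>" using y by blast
  qed (use \<epsilon> in simp)
qed

theorem proposition2p12:
  shows "admits_almost_Daugavet_points TYPE('a::banach) \<longleftrightarrow>
    (SUP x\<in>sphere (0::'a) 1. Daugavet_constant x) = 2"
proof
  assume adm: "admits_almost_Daugavet_points TYPE('a)"
  show "(SUP x\<in>sphere (0::'a) 1. Daugavet_constant x) = 2"
  proof (rule antisym)
    show "(SUP x\<in>sphere (0::'a) 1. Daugavet_constant x) \<le> 2"
      using Daugavet_constant_le_2 by (intro SUP_least) simp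
    show "2 \<le> (SUP x\<in>sphere (0::'a) 1. Daugavet_constant x)"
    proof (rule dense_le)
      fix b :: ereal assume "b < 2"
      then obtain r :: real where r: "b < ereal r" "ereal r < 2" using ereal_dense2 by blast
      \<comment> \<open>The first term keeps \<open>\<epsilon>\<close> below 1, so that
        \<open>x\<close> is nonzero; the second ensures
        \<open>r \<le> 2 - 2 * \<epsilon>\<close>.\<close>
      define \<epsilon> where "\<epsilon> = min (1 / 2) ((2 - r) / 2)"
      have \<epsilon>: "0 < \<epsilon>" "\<epsilon> < 1" "r \<le> 2 - 2 * \<epsilon>" using r(2) by (auto simp: \<epsilon>_def min_def field_simps)
      obtain x :: 'a where x: "x \<in> cball 0 1"
        "cball 0 1 \<subseteq> closure (convex hull (far_set \<epsilon> x))"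
        using adm \<epsilon> by (auto simp: admits_almost_Daugavet_points_def)
      note n = Daugavet_constant_normalize_ge[OF \<epsilon>(1,2) x]
      have "b \<le> ereal r" using r by simp
      also have "\<dots> \<le> ereal (2 - 2 * \<epsilon>)" using \<epsilon> by simp
      also have "\<dots> \<le> Daugavet_constant (x /\<^sub>R norm x)" by (rule n(2))
      also have "\<dots> \<le> (SUP x\<in>sphere (0::'a) 1. Daugavet_constant x)"
        using n(1) by (intro SUP_upper) simp
      finally show "b \<le> (SUP x\<in>sphere (0::'a) 1. Daugavet_constant x)" .
    qed
  qed
next
  assume sup: "(SUP x\<in>sphere (0::'a) 1. Daugavet_constant x) = 2"
  show "admits_almost_Daugavet_points TYPE('a)"
    unfolding admits_almost_Daugavet_points_def
  proof (intro allI impI)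
    fix \<epsilon> :: real assume "\<epsilon> > 0"
    then have "ereal (2 - \<epsilon>) < (SUP x\<in>sphere (0::'a) 1. Daugavet_constant x)"
      by (simp add: sup)
    then obtain x :: 'a where "norm x = 1" "ereal (2 - \<epsilon>) < Daugavet_constant x"
      by (auto simp: less_SUP_iff)
    then show "\<exists>x\<in>cball (0::'a) 1. cball 0 1 \<subseteq> closure (convex hull (far_set \<epsilon> x))"
      using ball_subset_hull_far_set by (intro bexI[of _ x]) auto
  qed
qed

end
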